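(* Let $G$ be any (finite or infinite) group with identity $\mathbf{1}$. Then every colour-permuting automorphism of the complete Cayley graph $\mathrm{Cay}(G; G\setminus\{\mathbf{1}\})$ is the composition of a group automorphism of $G$ and a colour-preserving graph automorphism of $\mathrm{Cay}(G; G\setminus\{\mathbf{1}\})$.
   Context: For an inverse-closed subset $S$ of a group $G$, the Cayley graph $\mathrm{Cay}(G;S)$ has vertex set $G$ and an edge from $g$ to $gs$ for each $g\in G$, $s\in S$; the edge $g$—$gs$ is coloured with the set $\{s,s^{-1}\}$. A graph automorphism is colour-preserving if it maps every edge to an edge of the same colour, and colour-permuting if whenever two edges have the same colour their images also have the same colour. *)

theory Defs
  imports "HOL-Algebra.Group"
begin

text \<open>Cayley graph Cay(G;S): vertices carrier G, an edge g -- g s for s in S.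
  For inverse-closed S this is the symmetric relation: inv g * h in S.\<close>
definition cay_edge :: "('a, 'b) monoid_scheme \<Rightarrow> 'a set \<Rightarrow> 'a \<Rightarrow> 'a \<Rightarrow> bool" where
  "cay_edge G S g h \<longleftrightarrow> g \<in> carrier G \<and> h \<in> carrier G \<and> inv\<^bsub>G\<^esub> g \<otimes>\<^bsub>G\<^esub> h \<in> S"

definition cay_colour :: "('a, 'b) monoid_scheme \<Rightarrow> 'a \<Rightarrow> 'a \<Rightarrow> 'a set" where
  "cay_colour G g h = {inv\<^bsub>G\<^esub> g \<otimes>\<^bsub>G\<^esub> h, inv\<^bsub>G\<^esub> (inv\<^bsub>G\<^esub> g \<otimes>\<^bsub>G\<^esub> h)}"

definition cay_graph_aut :: "('a, 'b) monoid_scheme \<Rightarrow> 'a set \<Rightarrow> ('a \<Rightarrow> 'a) \<Rightarrow> bool" where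
  "cay_graph_aut G S f \<longleftrightarrow> bij_betw f (carrier G) (carrier G) \<and>
     (\<forall>g\<in>carrier G. \<forall>h\<in>carrier G. cay_edge G S g h \<longleftrightarrow> cay_edge G S (f g) (f h))"

definition colour_preserving :: "('a, 'b) monoid_scheme \<Rightarrow> 'a set \<Rightarrow> ('a \<Rightarrow> 'a) \<Rightarrow> bool" where
  "colour_preserving G S f \<longleftrightarrow> cay_graph_aut G S f \<and>
     (\<forall>g h. cay_edge G S g h \<longrightarrow> cay_colour G (f g) (f h) = cay_colour G g h)"

definition colour_permuting :: "('a, 'b) monoid_scheme \<Rightarrow> 'a set \<Rightarrow> ('a \<Rightarrow> 'a) \<Rightarrow> bool" where
  "colour_permuting G S f \<longleftrightarrow> cay_graph_aut G S f \<and>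
     (\<forall>g h g' h'. cay_edge G S g h \<longrightarrow> cay_edge G S g' h' \<longrightarrow>
        cay_colour G g h = cay_colour G g' h' \<longrightarrow>
        cay_colour G (f g) (f h) = cay_colour G (f g') (f h'))"

end

theory Submission
  imports Defs "HOL-Algebra.Coset"
begin

text \<open>
  After a translation, a colour-permuting map becomes a bijection p of G with
  p(gh) = p(g) p(h) or p(g) p(h)^-1. Such a p maps involutions to involutions: if s is an
  involution and t = p(s) is not, then t must commute with every involution, and the values of p
  on the words in s, t and u = p(t) contradict each other.
  Consequently p(h^-1) = p(h)^-1, and p(gh) differs from p(g) p(h) only if p(g)^2 = p(h)^2.
  If p is not a homomorphism, such a pair g, h generates a quaternion group, and G is the product of
  this group with the central subgroup of elements of square 1. Inverting p on a single
  coset of this subgroup then gives an automorphism \<alpha> with \<alpha>(k) = p(k) or p(k)^-1 for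
  all k, so that \<alpha>^-1 f preserves colours.
\<close>

section \<open>Cancellation rules in groups\<close>

lemma (in group) l_cancel_inv [simp]:
  "\<lbrakk>x \<in> carrier G; y \<in> carrier G\<rbrakk> \<Longrightarrow> inv x \<otimes> (x \<otimes> y) = y"
  "\<lbrakk>x \<in> carrier G; y \<in> carrier G\<rbrakk> \<Longrightarrow> x \<otimes> (inv x \<otimes> y) = y"
  by (simp_all flip: m_assoc)

text \<open>Turns a relation between two elements into a rewrite rule that applies inside
  right-associated products; with \<open>m_assoc\<close> such rules compute normal forms of
  words.\<close>

lemma (in group) assoc_left:
  assumes "x \<otimes> y = z" "x \<in> carrier G" "y \<in> carrier G" "a \<in> carrier G"
  shows "x \<otimes> (y \<otimes> a) = z \<otimes> a"
  using assms by (simp flip: m_assoc)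

section \<open>Bijections that are multiplicative up to inverting the second factor\<close>

locale sign_mult_bij = group G for G (structure) +
  fixes p :: "'a \<Rightarrow> 'a"
  assumes bij: "bij_betw p (carrier G) (carrier G)"
    and sign_mult: "\<lbrakk>g \<in> carrier G; h \<in> carrier G\<rbrakk> \<Longrightarrow>
      p (g \<otimes> h) = p g \<otimes> p h \<or> p (g \<otimes> h) = p g \<otimes> inv (p h)"
begin

lemma p_closed [simp]: "x \<in> carrier G \<Longrightarrow> p x \<in> carrier G"
  using bij bij_betwE by blast

lemma p_eq_iff: "\<lbrakk>x \<in> carrier G; y \<in> carrier G\<rbrakk> \<Longrightarrow> p x = p y \<longleftrightarrow> x = y"
  using bij by (metis bij_betw_imp_inj_on inj_on_eq_iff)

lemma p_surj: "y \<in> carrier G \<Longrightarrow> \<exists>x\<in>carrier G. p x = y"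
  using bij by (metis bij_betw_imp_surj_on imageE)

lemma p_one [simp]: "p \<one> = \<one>"
  using sign_mult[of \<one> \<one>] by (metis l_one one_closed p_closed r_cancel_one r_inv)

lemma p_eq_one: "x \<in> carrier G \<Longrightarrow> p x = \<one> \<longleftrightarrow> x = \<one>"
  using p_eq_iff[of x \<one>] by simp

text \<open>The other value p(h) p(h)^-1 = 1 is excluded by injectivity.\<close>

lemma p_square:
  assumes "h \<in> carrier G" "h \<otimes> h \<noteq> \<one>"
  shows "p (h \<otimes> h) = p h \<otimes> p h"
  using sign_mult[of h h] assms p_eq_one[of "h \<otimes> h"] by auto

lemma p_square_ne_one:
  assumes "h \<in> carrier G" "h \<otimes> h \<noteq> \<one>"
  shows "p h \<otimes> p h \<noteq> \<one>"
  using p_square[OF assms] p_eq_one[of "h \<otimes> h"] assms by auto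

lemma p_mult_involution:
  assumes "g \<in> carrier G" "h \<in> carrier G" "p h \<otimes> p h = \<one>"
  shows "p (g \<otimes> h) = p g \<otimes> p h"
  using sign_mult[of g h] assms inv_equality by auto

section \<open>Involutions are mapped to involutions\<close>

text \<open>Since h = s(sh), the sign rule for the pairs (s, h) and (s, sh) leaves four
  combinations. One gives u = t^2 u and is impossible; each of the others simplifies to one of the
  listed relations.\<close>

lemma bad_trichotomy:
  assumes s: "s \<in> carrier G" "s \<otimes> s = \<one>" and t: "p s = t" "t \<otimes> t \<noteq> \<one>"
    and h: "h \<in> carrier G" "p h = u"
  shows "p (s \<otimes> h) = t \<otimes> u \<and> t \<otimes> u = inv u \<otimes> t \<or>
    p (s \<otimes> h) = t \<otimes> inv u \<and> (u \<otimes> u = t \<otimes> t \<or> t \<otimes> u = u \<otimes> t)"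
proof -
  have c [simp]: "t \<in> carrier G" "u \<in> carrier G"
    using s(1) t(1) h p_closed by blast+
  have eq: "s \<otimes> (s \<otimes> h) = h"
    using s h by (simp flip: m_assoc)
  have 1: "p (s \<otimes> h) = t \<otimes> u \<or> p (s \<otimes> h) = t \<otimes> inv u"
    using sign_mult[of s h] s h t by simp
  have 2: "u = t \<otimes> p (s \<otimes> h) \<or> u = t \<otimes> inv (p (s \<otimes> h))"
    using sign_mult[of s "s \<otimes> h"] s h t by (simp add: eq)
  have "t \<otimes> t \<otimes> u \<noteq> u"
    using t(2) by simp
  moreover have "t \<otimes> u = inv u \<otimes> t" if "u = t \<otimes> inv (t \<otimes> u)"
  proof -
    have "u = t \<otimes> (inv u \<otimes> inv t)" using that by (simp add: inv_mult_group)
    then show ?thesis by (metis c inv_closed inv_inv inv_mult_group inv_solve_left' inv_solve_right' m_assoc m_closed)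
  qed
  moreover have "u \<otimes> u = t \<otimes> t" if "u = t \<otimes> (t \<otimes> inv u)"
    using that by (metis c inv_closed inv_solve_right m_assoc m_closed)
  moreover have "t \<otimes> u = u \<otimes> t" if "u = t \<otimes> inv (t \<otimes> inv u)"
  proof -
    have "u = t \<otimes> u \<otimes> inv t" using that by (simp add: inv_mult_group m_assoc)
    then show ?thesis by (metis c inv_solve_right m_closed)
  qed
  ultimately show ?thesis
    using 1 2 by (metis c m_assoc)
qed

text \<open>
  With u = p(t) and v = p(u), the element c = t^2 is central of order 2. If p(s) = t is not an
  involution, then the square d of su is also the square of stu, which gives both
  p(d) = (tv)^2 and p(d) = (tuv)^2 = c (tv)^2.
\<close>
lemma p_involution:
  assumes s: "s \<in> carrier G" "s \<otimes> s = \<one>"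
  shows "p s \<otimes> p s = \<one>"
proof (rule ccontr)
  define t where "t = p s"
  define u where "u = p t"
  define v where "v = p u"
  define c where "c = t \<otimes> t"
  assume "p s \<otimes> p s \<noteq> \<one>"
  then have c1: "c \<noteq> \<one>" by (simp add: c_def t_def)
  have [simp]: "s \<in> carrier G" "t \<in> carrier G" "u \<in> carrier G" "v \<in> carrier G" "c \<in> carrier G"
    using s by (simp_all add: t_def u_def v_def c_def)
  have tri: "p (s \<otimes> h) = t \<otimes> p h \<and> t \<otimes> p h = inv (p h) \<otimes> t \<or>
    p (s \<otimes> h) = t \<otimes> inv (p h) \<and> (p h \<otimes> p h = t \<otimes> t \<or> t \<otimes> p h = p h \<otimes> t)"
    if "h \<in> carrier G" for h
    using bad_trichotomy[OF s] that c1 by (simp add: t_def c_def)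
  have tri': "t \<otimes> y = inv y \<otimes> t \<or> y \<otimes> y = t \<otimes> t \<or> t \<otimes> y = y \<otimes> t" if "y \<in> carrier G" for y
    using tri p_surj[OF that] by blast
  have invol: "t \<otimes> y = y \<otimes> t" if "y \<in> carrier G" "y \<otimes> y = \<one>" for y
    using tri'[OF that(1)] that c1 inv_equality[of y y] by (auto simp: c_def)
  have tt: "t \<otimes> t \<noteq> \<one>" using c1 by (simp add: c_def)
  then have uu1: "u \<otimes> u \<noteq> \<one>"
    using p_square_ne_one[of t] by (simp add: u_def)
  have st: "s \<otimes> t = t \<otimes> s" using invol[OF s] by simp
  \<comment> \<open>As \<open>s\<close> and \<open>t\<close> commute, p(st) is also p(ts). Comparing
    this expansion with \<open>tri\<close> at \<open>t\<close> determines how \<open>t\<close> and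
    \<open>u\<close> interact.\<close>
  have pst: "p (s \<otimes> t) = u \<otimes> t \<or> p (s \<otimes> t) = u \<otimes> inv t"
    using sign_mult[of t s] st by (simp add: u_def t_def)
  have A: "x \<otimes> x = \<one>" if "inv x \<otimes> y = x \<otimes> y" "x \<in> carrier G" "y \<in> carrier G" for x y
    using that by (metis inv_closed right_cancel r_inv)
  have B: "x \<otimes> x = y \<otimes> y" if "inv x \<otimes> y = x \<otimes> inv y" "x \<in> carrier G" "y \<in> carrier G" for x y
    using that by (metis inv_closed inv_solve_left inv_solve_right m_assoc m_closed)
  have comm_inv: "t \<otimes> inv u = inv u \<otimes> t" if "t \<otimes> u = u \<otimes> t"
    using that by (metis \<open>t \<in> carrier G\<close> \<open>u \<in> carrier G\<close> inv_closed inv_solve_left inv_solve_right m_assoc m_closed)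
  \<comment> \<open>If \<open>t\<close> and \<open>u\<close> commuted, then p(st) = u^-1 t and u^2 =
    t^2, so p(st) would have square 1, although the square of st is t^2 and not 1.\<close>
  have not_comm: "t \<otimes> u \<noteq> u \<otimes> t"
  proof
    assume tu: "t \<otimes> u = u \<otimes> t"
    have "p (s \<otimes> t) = inv u \<otimes> t"
      using tri[of t] tu comm_inv by (auto simp: u_def)
    with pst have uu: "u \<otimes> u = t \<otimes> t" using A[of u t] B[of u t] uu1 by auto
    have "s \<otimes> t \<otimes> (s \<otimes> t) = t \<otimes> t"
      using st s by (metis \<open>s \<in> carrier G\<close> \<open>t \<in> carrier G\<close> l_one m_assoc m_closed)
    then have "p (s \<otimes> t) \<otimes> p (s \<otimes> t) \<noteq> \<one>"
      using p_square_ne_one[of "s \<otimes> t"] tt by simp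
    moreover have "inv u \<otimes> t \<otimes> (inv u \<otimes> t) = \<one>"
    proof -
      have "inv u \<otimes> t \<otimes> (inv u \<otimes> t) = inv u \<otimes> (inv u \<otimes> (t \<otimes> t))"
        using comm_inv[OF tu] by (metis \<open>t \<in> carrier G\<close> \<open>u \<in> carrier G\<close> inv_closed m_assoc m_closed)
      also have "\<dots> = \<one>" by (simp add: uu[symmetric])
      finally show ?thesis .
    qed
    ultimately show False using \<open>p (s \<otimes> t) = inv u \<otimes> t\<close> by simp
  qed
  have tu: "t \<otimes> u = inv u \<otimes> t" and uu: "u \<otimes> u = c"
  proof -
    have "t \<otimes> u = inv u \<otimes> t \<and> u \<otimes> u = c"
      using tri[OF \<open>t \<in> carrier G\<close>]
    proof (elim disjE conjE)
      assume "p (s \<otimes> t) = t \<otimes> p t" "t \<otimes> p t = inv (p t) \<otimes> t"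
      then show ?thesis using pst A[of u t] B[of u t] uu1 by (auto simp: u_def[symmetric] c_def)
    next
      assume 1: "p (s \<otimes> t) = t \<otimes> inv (p t)" and 2: "p t \<otimes> p t = t \<otimes> t"
      from pst show ?thesis
      proof
        assume "p (s \<otimes> t) = u \<otimes> t"
        then have "t \<otimes> inv u = u \<otimes> t" using 1 by (simp add: u_def)
        then have "t \<otimes> u = inv u \<otimes> t" 
          by (metis \<open>t \<in> carrier G\<close> \<open>u \<in> carrier G\<close> inv_closed inv_solve_left inv_solve_right m_assoc m_closed)
        then show ?thesis using 2 by (simp add: u_def c_def)
      next
        assume "p (s \<otimes> t) = u \<otimes> inv t"
        then have *: "t \<otimes> inv u = u \<otimes> inv t" using 1 by (simp add: u_def)
        have "u \<otimes> inv t = inv u \<otimes> t"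
          using 2 by (metis u_def \<open>t \<in> carrier G\<close> \<open>u \<in> carrier G\<close> inv_closed inv_solve_left inv_solve_right m_assoc m_closed)
        then have "t \<otimes> u = u \<otimes> t" using *
          by (metis \<open>t \<in> carrier G\<close> \<open>u \<in> carrier G\<close> inv_closed inv_solve_left inv_solve_right m_assoc m_closed)
        then show ?thesis using not_comm by simp
      qed
    next
      assume "t \<otimes> p t = p t \<otimes> t"
      then show ?thesis using not_comm by (simp add: u_def)
    qed
    then show "t \<otimes> u = inv u \<otimes> t" "u \<otimes> u = c" by auto
  qed
  \<comment> \<open>Conjugation by \<open>t\<close> inverts \<open>u\<close>, hence also c = u^2;
    but \<open>t\<close> commutes with c = t^2.\<close>
  have cc: "c \<otimes> c = \<one>"
  proof -
    have "t \<otimes> (u \<otimes> u) = inv u \<otimes> inv u \<otimes> t"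
      using tu by (metis \<open>t \<in> carrier G\<close> \<open>u \<in> carrier G\<close> inv_closed m_assoc)
    then have "t \<otimes> c = inv c \<otimes> t"
      by (simp add: uu flip: inv_mult_group)
    moreover have "t \<otimes> c = c \<otimes> t" by (simp add: c_def m_assoc)
    ultimately have "inv c \<otimes> t = c \<otimes> t" by simp
    then show ?thesis by (metis A \<open>t \<in> carrier G\<close> \<open>c \<in> carrier G\<close>)
  qed
  \<comment> \<open>Each relation in \<open>tri'\<close> makes \<open>y\<close> commute with t^2; in
    the first one, conjugating twice by \<open>t\<close> inverts \<open>y\<close> twice.\<close>
  have central: "y \<otimes> c = c \<otimes> y" if [simp]: "y \<in> carrier G" for y
    using tri'[OF that]
  proof (elim disjE)
    assume "t \<otimes> y = inv y \<otimes> t"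
    then have "t \<otimes> inv y = y \<otimes> t" "t \<otimes> y = inv y \<otimes> t"
      by (metis \<open>t \<in> carrier G\<close> that inv_closed inv_solve_left inv_solve_right m_assoc m_closed)+
    then show ?thesis unfolding c_def
      by (metis \<open>t \<in> carrier G\<close> that inv_closed m_assoc)
  next
    assume "y \<otimes> y = t \<otimes> t"
    then show ?thesis by (metis c_def m_assoc that)
  next
    assume "t \<otimes> y = y \<otimes> t"
    then show ?thesis unfolding c_def
      by (metis \<open>t \<in> carrier G\<close> that m_assoc)
  qed
  have pc: "p c = c"
    using p_square[of t] tt uu by (simp add: c_def u_def)
  have vv: "v \<otimes> v = c"
    using p_square[of u] uu1 uu pc by (simp add: v_def)
  have inv_root: "inv y = c \<otimes> y" if "y \<in> carrier G" "y \<otimes> y = c" for y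
    using that cc by (metis \<open>c \<in> carrier G\<close> inv_equality m_assoc m_closed)
  have ut: "u \<otimes> t = c \<otimes> (t \<otimes> u)"
    using tu inv_root[of u] uu cc by (simp add: m_assoc) (simp flip: m_assoc add: cc)
  \<comment> \<open>These rules move \<open>c\<close> to the front and replace squares by
    \<open>c\<close>; \<open>ac'\<close> also moves \<open>t\<close> in front of
    \<open>u\<close>.\<close>
  note ac = m_assoc cc assoc_left[OF cc] uu assoc_left[OF uu] vv assoc_left[OF vv]
    c_def[symmetric] assoc_left[OF c_def[symmetric]]
    central[of s] central[of t] central[of u] central[of v]
    assoc_left[OF central[of s]] assoc_left[OF central[of t]]
    assoc_left[OF central[of u]] assoc_left[OF central[of v]]
  note ac' = ac ut assoc_left[OF ut]
  \<comment> \<open>Inverting an element of square \<open>c\<close> multiplies it by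
    \<open>c\<close>, so each sign ambiguity becomes a central factor \<open>c\<close>, which
    vanishes on squaring.\<close>
  have ptu: "p (t \<otimes> u) = u \<otimes> v \<or> p (t \<otimes> u) = c \<otimes> (u \<otimes> v)"
    using sign_mult[of t u] inv_root[of v] vv by (auto simp: u_def[symmetric] v_def[symmetric] ac)
  have "t \<otimes> u \<otimes> (t \<otimes> u) = c"
    by (simp add: ac')
  then have "p (t \<otimes> u) \<otimes> p (t \<otimes> u) = c"
    using p_square[of "t \<otimes> u"] c1 pc by simp
  note ptu2 = this
  have uv2: "u \<otimes> v \<otimes> (u \<otimes> v) = c"
    using ptu
  proof
    assume "p (t \<otimes> u) = u \<otimes> v"
    from ptu2[unfolded this] show ?thesis .
  next
    assume "p (t \<otimes> u) = c \<otimes> (u \<otimes> v)"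
    from ptu2[unfolded this] show ?thesis by (simp add: ac)
  qed
  have vu: "v \<otimes> u = c \<otimes> (u \<otimes> v)"
  proof -
    have "u \<otimes> (u \<otimes> v \<otimes> (u \<otimes> v)) \<otimes> v = u \<otimes> c \<otimes> v" by (simp add: uv2)
    then show ?thesis by (simp add: ac)
  qed
  define d where "d = s \<otimes> u \<otimes> (s \<otimes> u)"
  \<comment> \<open>If su were an involution, it would commute with \<open>t\<close>; since
    \<open>s\<close> does, so would \<open>u\<close>.\<close>
  have d1: "d \<noteq> \<one>"
  proof
    assume "d = \<one>"
    then have "t \<otimes> (s \<otimes> u) = s \<otimes> u \<otimes> t" using invol[of "s \<otimes> u"] by (simp add: d_def)
    then have "s \<otimes> (t \<otimes> u) = s \<otimes> (u \<otimes> t)"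
      using st by (metis \<open>s \<in> carrier G\<close> \<open>t \<in> carrier G\<close> \<open>u \<in> carrier G\<close> m_assoc)
    then show False using not_comm by simp
  qed
  have psu: "p (s \<otimes> u) = t \<otimes> v \<or> p (s \<otimes> u) = c \<otimes> (t \<otimes> v)"
    using sign_mult[of s u] inv_root[of v] vv by (auto simp: t_def[symmetric] v_def[symmetric] ac)
  have pd: "p d = t \<otimes> v \<otimes> (t \<otimes> v)"
    using p_square[of "s \<otimes> u"] d1 psu by (auto simp: d_def ac)
  have pstu: "p (s \<otimes> (t \<otimes> u)) = t \<otimes> (u \<otimes> v) \<or> p (s \<otimes> (t \<otimes> u)) = c \<otimes> (t \<otimes> (u \<otimes> v))"
  proof -
    have "inv (p (t \<otimes> u)) = c \<otimes> p (t \<otimes> u)" using ptu2 by (intro inv_root) simp_all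
    then show ?thesis
      using sign_mult[of s "t \<otimes> u"] ptu
      by (elim disjE) (auto simp: t_def[symmetric] ac)
  qed
  have ts: "t \<otimes> s = s \<otimes> t" by (simp add: st)
  \<comment> \<open>Here \<open>t\<close> commutes with \<open>s\<close>, and the factor
    \<open>c\<close> from passing it over \<open>u\<close> cancels t^2 = c.\<close>
  have "s \<otimes> (t \<otimes> u) \<otimes> (s \<otimes> (t \<otimes> u)) = d"
  proof -
    have "s \<otimes> (t \<otimes> u) \<otimes> (s \<otimes> (t \<otimes> u)) = s \<otimes> t \<otimes> (u \<otimes> (s \<otimes> t \<otimes> u))" by (simp add: m_assoc)
    also have "\<dots> = t \<otimes> (s \<otimes> u \<otimes> t) \<otimes> (s \<otimes> u)" by (simp add: st m_assoc)
    also have "\<dots> = d" unfolding d_def by (simp add: ac ut assoc_left[OF ut] ts assoc_left[OF ts])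
    finally show ?thesis .
  qed
  then have "p d = t \<otimes> (u \<otimes> v) \<otimes> (t \<otimes> (u \<otimes> v))"
    using p_square[of "s \<otimes> (t \<otimes> u)"] d1 pstu by (auto simp: ac)
  \<comment> \<open>Both factors \<open>u\<close> move to the front. The first passes t, the second
    t, v, t; these four swaps contribute c^4 = 1, and u^2 = c remains.\<close>
  also have "\<dots> = c \<otimes> (t \<otimes> v \<otimes> (t \<otimes> v))"
  proof -
    have tu': "t \<otimes> u = c \<otimes> (u \<otimes> t)"
      by (simp add: ut assoc_left[OF cc])
    show ?thesis
      by (simp add: ac tu' assoc_left[OF tu'] vu assoc_left[OF vu])
  qed
  finally show False using pd c1 by (simp del: m_assoc)
qed

section \<open>Squares, inverses, and pairs at which multiplicativity fails\<close>

lemma p_square_hom: "h \<in> carrier G \<Longrightarrow> p (h \<otimes> h) = p h \<otimes> p h"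
  using p_square p_involution by (metis p_one)

text \<open>In the sign rule for the product of h^-1 and \<open>h\<close>, the wrong sign would mean
  p(h^-1) = p(h); then \<open>h\<close> is its own inverse and \<open>p_involution\<close>
  applies.\<close>

lemma p_inv: 
  assumes h: "h \<in> carrier G"
  shows "p (inv h) = inv (p h)"
proof -
  consider "\<one> = p (inv h) \<otimes> p h" | "\<one> = p (inv h) \<otimes> inv (p h)"
    using sign_mult[of "inv h" h] h by auto
  then show ?thesis
  proof cases
    case 1
    then show ?thesis using h by (metis inv_closed inv_equality p_closed)
  next
    case 2
    then have "p (inv h) = p h"
      using h by (metis inv_closed inv_equality inv_inv p_closed)
    then have "inv h = h" using h by (simp add: p_eq_iff)
    then have "h \<otimes> h = \<one>" using h by (metis r_inv)
    then have "p h \<otimes> p h = \<one>" using h p_involution by simp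
    then show ?thesis using \<open>inv h = h\<close> h by (simp add: inv_equality)
  qed
qed

text \<open>With x = p(g) and y = p(h), failure means p(gh) = x y^-1. Comparison with
  \<open>p\<close> at the inverse of gh gives x^2 = y^2; evaluating \<open>p\<close> at g^2 h and at
  g h^2 then gives xy = w yx and w^2 = 1. These are the quaternion relations, with \<open>w\<close>
  in the role of -1.\<close>

lemma twisted:
  assumes g: "g \<in> carrier G" and h: "h \<in> carrier G" and ne: "p (g \<otimes> h) \<noteq> p g \<otimes> p h"
    and w: "w = p g \<otimes> p g"
  shows "p h \<otimes> p h = w" "w \<noteq> \<one>" "w \<otimes> w = \<one>"
    "p h \<otimes> p g = w \<otimes> (p g \<otimes> p h)" "p (g \<otimes> h) = w \<otimes> (p g \<otimes> p h)"
proof -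
  define x where "x = p g"
  define y where "y = p h"
  define z where "z = g \<otimes> g"
  have [simp]: "g \<in> carrier G" "h \<in> carrier G" "x \<in> carrier G" "y \<in> carrier G" "w \<in> carrier G" "z \<in> carrier G"
    using g h w by (simp_all add: x_def y_def z_def)
  have xx: "x \<otimes> x = w" by (simp add: w x_def)
  have pgh: "p (g \<otimes> h) = x \<otimes> inv y"
    using sign_mult[of g h] ne by (auto simp: x_def y_def)
  have inv_pgh: "inv (p (g \<otimes> h)) = p (inv h \<otimes> inv g)"
    by (simp flip: p_inv add: inv_mult_group)
  have "p (inv h \<otimes> inv g) \<noteq> inv y \<otimes> inv x"
  proof
    assume "p (inv h \<otimes> inv g) = inv y \<otimes> inv x"
    then have "inv (p (g \<otimes> h)) = inv (x \<otimes> y)"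
      using inv_pgh by (simp add: inv_mult_group)
    then have "p (g \<otimes> h) = x \<otimes> y"
      by (metis g h inv_inv m_closed p_closed \<open>x \<in> carrier G\<close> \<open>y \<in> carrier G\<close>)
    then show False
      using ne by (simp add: x_def y_def)
  qed
  then have "inv (p (g \<otimes> h)) = inv y \<otimes> x"
    using sign_mult[of "inv h" "inv g"] inv_pgh by (auto simp: p_inv x_def y_def)
  then have "y \<otimes> inv x = inv y \<otimes> x"
    by (simp add: pgh inv_mult_group)
  then have "y \<otimes> y = x \<otimes> x"
    by (metis \<open>x \<in> carrier G\<close> \<open>y \<in> carrier G\<close> inv_closed inv_solve_left inv_solve_right m_assoc m_closed)
  then have yy: "y \<otimes> y = w" by (simp add: xx)
  have w1: "w \<noteq> \<one>"
  proof
    assume "w = \<one>"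
    then have "inv y = y" using yy by (simp add: inv_equality)
    then show False using pgh ne by (simp add: x_def y_def)
  qed
  have pz: "p z = w" by (simp add: z_def p_square_hom w)
  have z1: "z \<noteq> \<one>" using pz w1 by auto
  have hh: "h \<otimes> h = z"
    using yy pz p_square_hom[of h] p_eq_iff[of "h \<otimes> h" z] by (simp add: y_def)
  \<comment> \<open>The other sign would give p(zk) = p(k), although \<open>z\<close> is not the
    identity.\<close>
  have pzk: "p (z \<otimes> k) = w \<otimes> p k" if "k \<in> carrier G" "p k \<otimes> p k = w" for k
  proof (rule ccontr)
    assume "p (z \<otimes> k) \<noteq> w \<otimes> p k"
    then have "p (z \<otimes> k) = p k \<otimes> p k \<otimes> inv (p k)"
      using sign_mult[of z k] that pz by auto
    also have "\<dots> = p k" using that(1) by (simp add: m_assoc)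
    finally have "z \<otimes> k = k" using that by (simp add: p_eq_iff)
    then show False using z1 that by simp
  qed
  have wx: "w \<otimes> x = x \<otimes> w" unfolding xx[symmetric] by (simp add: m_assoc)
  have wy: "w \<otimes> y = y \<otimes> w" unfolding yy[symmetric] by (simp add: m_assoc)
  have "p (g \<otimes> (g \<otimes> h)) = w \<otimes> y"
    using pzk[of h] yy by (simp add: z_def m_assoc y_def)
  moreover have "p (g \<otimes> (g \<otimes> h)) = x \<otimes> (x \<otimes> inv y) \<or> p (g \<otimes> (g \<otimes> h)) = x \<otimes> inv (x \<otimes> inv y)"
    using sign_mult[of g "g \<otimes> h"] by (simp add: pgh) (simp add: x_def)
  moreover have "x \<otimes> (x \<otimes> inv y) = y"
    using xx yy by (metis \<open>x \<in> carrier G\<close> \<open>y \<in> carrier G\<close> inv_closed inv_solve_right m_assoc m_closed)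
  moreover have "w \<otimes> y \<noteq> y" using w1 by simp
  ultimately have "w \<otimes> y = x \<otimes> (y \<otimes> inv x)"
    by (simp add: inv_mult_group)
  then have xy: "x \<otimes> y = w \<otimes> (y \<otimes> x)"
    by (metis \<open>x \<in> carrier G\<close> \<open>y \<in> carrier G\<close> \<open>w \<in> carrier G\<close> inv_closed inv_solve_right m_assoc m_closed)
  have "g \<otimes> h \<otimes> h = z \<otimes> g"
    by (simp add: m_assoc hh) (simp add: z_def m_assoc)
  then have "p (g \<otimes> h \<otimes> h) = w \<otimes> x"
    using pzk[of g] xx by (simp add: x_def)
  moreover have "p (g \<otimes> h \<otimes> h) = x \<otimes> inv y \<otimes> y \<or> p (g \<otimes> h \<otimes> h) = x \<otimes> inv y \<otimes> inv y"
    using sign_mult[of "g \<otimes> h" h] by (simp add: pgh) (simp add: y_def)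
  moreover have "w \<otimes> x \<noteq> x" using w1 by simp
  ultimately have "x \<otimes> w = x \<otimes> inv w"
    using wx by (auto simp: m_assoc yy[symmetric] inv_mult_group)
  then have "inv w = w" by simp
  then show ww: "w \<otimes> w = \<one>" by (metis \<open>w \<in> carrier G\<close> r_inv)
  show "p h \<otimes> p h = w" "w \<noteq> \<one>" using yy w1 by (simp_all add: y_def)
  show "p h \<otimes> p g = w \<otimes> (p g \<otimes> p h)"
    using xy ww by (simp add: x_def[symmetric] y_def[symmetric]) (simp flip: m_assoc)
  have "inv y = w \<otimes> y"
    using ww yy by (intro inv_equality) (simp_all add: m_assoc)
  then show "p (g \<otimes> h) = w \<otimes> (p g \<otimes> p h)"
    using wx by (simp add: pgh x_def[symmetric] y_def[symmetric]) (simp flip: m_assoc)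
qed

text \<open>Both p(g) and p(gh) have the square w = p(g)^2, which differs from p(k)^2, so
  \<open>p\<close> is multiplicative at (k, g) and (k, gh). Hence multiplicativity fails at (kg, h),
  and \<open>twisted\<close> gives (p(k) p(g))^2 = p(g)^2.\<close>

lemma twisted_product:
  assumes g: "g \<in> carrier G" and h: "h \<in> carrier G" and ne: "p (g \<otimes> h) \<noteq> p g \<otimes> p h"
    and k: "k \<in> carrier G" "p k \<otimes> p k \<noteq> p g \<otimes> p g"
  shows "p k \<otimes> p g \<otimes> p k = p g"
proof -
  define w where "w = p g \<otimes> p g"
  note tw = twisted[OF g h ne w_def]
  have [simp]: "w \<in> carrier G" using g by (simp add: w_def)
  have wx: "p g \<otimes> w = w \<otimes> p g" using g by (simp add: w_def m_assoc)
  have wy: "p h \<otimes> w = w \<otimes> p h" using h tw(1)[symmetric] by (simp add: m_assoc)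
  have pgh2: "p (g \<otimes> h) \<otimes> p (g \<otimes> h) = w"
    using g h tw wx wy
    by (simp add: m_assoc assoc_left[OF tw(4)] assoc_left[OF tw(3)] assoc_left[OF wx]
        assoc_left[OF wy] assoc_left[OF tw(1)]
        w_def[symmetric] assoc_left[OF w_def[symmetric]])
  have kw: "p k \<otimes> p k \<noteq> w" using k by (simp add: w_def)
  have 1: "p (k \<otimes> g) = p k \<otimes> p g"
    using twisted(1)[of k g] g k kw by (force simp: w_def)
  have 2: "p (k \<otimes> (g \<otimes> h)) = p k \<otimes> p (g \<otimes> h)"
    using twisted(1)[of k "g \<otimes> h"] g h k kw pgh2 by force
  have "p (k \<otimes> g \<otimes> h) \<noteq> p (k \<otimes> g) \<otimes> p h"
    using 1 2 ne g h k by (simp add: m_assoc)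
  from twisted(1)[OF _ _ this refl] have "p k \<otimes> p g \<otimes> (p k \<otimes> p g) = p g \<otimes> p g"
    using g h k 1 tw(1) by (simp add: w_def)
  then show ?thesis using g k by (simp flip: m_assoc)
qed

end

section \<open>The group structure forced by a failing pair\<close>

locale twisted_pair = sign_mult_bij +
  fixes g h
  assumes g [simp]: "g \<in> carrier G" and h [simp]: "h \<in> carrier G"
    and ne: "p (g \<otimes> h) \<noteq> p g \<otimes> p h"
begin

definition "x = p g"
definition "y = p h"
definition "z = g \<otimes> g"
text \<open>By \<open>xx\<close> this is the square of \<open>x\<close>, the element -1 of the
  quaternion group generated by \<open>x\<close> and \<open>y\<close>.\<close>

definition "w = p z"
text \<open>By \<open>L_mult\<close> and \<open>L_central\<close> this set is a central subgroup; by
  \<open>decompose\<close> at most four cosets of it cover the group.\<close>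

definition "L = {a \<in> carrier G. a \<otimes> a = \<one>}"

lemma closed [simp]:
  "x \<in> carrier G" "y \<in> carrier G" "z \<in> carrier G" "w \<in> carrier G"
  by (simp_all add: x_def y_def z_def w_def)

lemma L_closed: "a \<in> L \<Longrightarrow> a \<in> carrier G"
  by (simp add: L_def)

lemma xx: "x \<otimes> x = w"
  by (simp add: x_def w_def z_def p_square_hom)

lemma quaternion: "y \<otimes> y = w" "w \<noteq> \<one>" "w \<otimes> w = \<one>" "y \<otimes> x = w \<otimes> (x \<otimes> y)"
  "p (g \<otimes> h) = w \<otimes> (x \<otimes> y)"
proof -
  have "w = p g \<otimes> p g" using xx by (simp add: x_def)
  from twisted[OF g h ne this] show "y \<otimes> y = w" "w \<noteq> \<one>" "w \<otimes> w = \<one>"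
    "y \<otimes> x = w \<otimes> (x \<otimes> y)" "p (g \<otimes> h) = w \<otimes> (x \<otimes> y)"
    by (simp_all add: x_def y_def)
qed

lemma w_comm: "x \<otimes> w = w \<otimes> x" "y \<otimes> w = w \<otimes> y"
  by (simp add: xx[symmetric] m_assoc, simp add: quaternion(1)[symmetric] m_assoc)

lemmas q_simps = m_assoc xx assoc_left[OF xx] quaternion(1,3,4) assoc_left[OF quaternion(1)]
  assoc_left[OF quaternion(3)] assoc_left[OF quaternion(4)]
  w_comm assoc_left[OF w_comm(1)] assoc_left[OF w_comm(2)]

lemma p_mem_L_iff: "a \<in> carrier G \<Longrightarrow> p a \<in> L \<longleftrightarrow> a \<in> L"
  using p_square_ne_one[of a] p_involution[of a] by (auto simp: L_def)

lemma p_mult_L: "\<lbrakk>k \<in> carrier G; l \<in> L\<rbrakk> \<Longrightarrow> p (k \<otimes> l) = p k \<otimes> p l"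
  by (rule p_mult_involution) (auto simp: L_def p_involution)

lemma p_L_mult: "\<lbrakk>k \<in> carrier G; l \<in> L\<rbrakk> \<Longrightarrow> p (l \<otimes> k) = p l \<otimes> p k"
  using twisted(2)[OF _ _ _ refl, of l k] p_involution[of l] by (auto simp: L_def)

lemma w_L: "w \<in> L"
  by (simp add: L_def quaternion)

lemma z_L: "z \<in> L"
  using p_mem_L_iff[of z] w_L by (simp add: w_def)

lemma z_ne: "z \<noteq> \<one>"
  using quaternion(2) by (auto simp: w_def)

lemma hh: "h \<otimes> h = z"
  using quaternion(1) p_square_hom[of h] p_eq_iff[of "h \<otimes> h" z] by (simp add: w_def y_def)

lemma zz: "z \<otimes> z = \<one>"
  using z_L by (simp add: L_def)

text \<open>The square of p(gh) is \<open>w\<close>, so gh has square \<open>z\<close>, like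
  \<open>g\<close> and \<open>h\<close>; the relation follows by cancelling in g (gh)^2 h = g z
  h.\<close>

lemma hg: "h \<otimes> g = z \<otimes> (g \<otimes> h)"
proof -
  have "p (g \<otimes> h \<otimes> (g \<otimes> h)) = w"
    using p_square_hom[of "g \<otimes> h"] by (simp add: quaternion(5) q_simps)
  then have "g \<otimes> h \<otimes> (g \<otimes> h) = z"
    using p_eq_iff[of "g \<otimes> h \<otimes> (g \<otimes> h)" z] by (simp add: w_def)
  then have "g \<otimes> (g \<otimes> h \<otimes> (g \<otimes> h)) \<otimes> h = g \<otimes> z \<otimes> h" by simp
  then have "z \<otimes> (h \<otimes> g) \<otimes> z = g \<otimes> z \<otimes> h" 
    by (simp add: m_assoc hh assoc_left[OF z_def[symmetric]])
  moreover have "g \<otimes> z = z \<otimes> g" by (simp add: z_def m_assoc)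
  moreover have "h \<otimes> z = z \<otimes> h" by (simp add: hh[symmetric] m_assoc)
  ultimately show ?thesis
    by (simp add: m_assoc)
      (metis g h closed(3) zz assoc_left l_one m_assoc m_closed)
qed

text \<open>If a^2 is not \<open>w\<close>, \<open>twisted_product\<close> at the failing pairs (g,
  h), (h, g) and (gh, h) gives a q a = q for q = x, y, wxy. By the first two, conjugation by
  \<open>x\<close> or \<open>y\<close> inverts \<open>a\<close>, so \<open>a\<close> commutes with
  wxy; the third then forces a^2 = 1.\<close>

lemma xy_L:
  assumes a: "a \<in> carrier G"
  shows "a \<otimes> a = w \<or> a \<otimes> a = \<one> \<and> a \<otimes> x = x \<otimes> a \<and> a \<otimes> y = y \<otimes> a"
proof (cases "a \<otimes> a = w")
  case False
  obtain k where k: "k \<in> carrier G" "p k = a" using p_surj[OF a] by blast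
  have phg: "p (h \<otimes> g) \<noteq> p h \<otimes> p g"
  proof -
    have "p (h \<otimes> g) = w \<otimes> (w \<otimes> (x \<otimes> y))"
      using p_L_mult[OF _ z_L] by (simp add: hg quaternion(5) w_def)
    then show ?thesis
      using quaternion(2) by (simp add: q_simps flip: x_def y_def)
  qed
  have pghh: "p (g \<otimes> h \<otimes> h) \<noteq> p (g \<otimes> h) \<otimes> p h"
    using p_mult_L[OF g z_L] quaternion(2)
    by (simp add: m_assoc hh quaternion(5) flip: x_def y_def w_def) (simp add: q_simps)
  have ax: "a \<otimes> x \<otimes> a = x"
    using twisted_product[OF g h ne k(1)] False by (simp add: k xx flip: x_def)
  have ay: "a \<otimes> y \<otimes> a = y"
    using twisted_product[OF h g phg k(1)] False by (simp add: k quaternion flip: y_def)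
  have axy: "a \<otimes> (w \<otimes> (x \<otimes> y)) \<otimes> a = w \<otimes> (x \<otimes> y)"
    using twisted_product[OF _ h pghh k(1)] False by (simp add: k quaternion(5)) (simp add: q_simps)
  have ax': "a \<otimes> x = x \<otimes> inv a" and ay': "a \<otimes> y = y \<otimes> inv a"
    using ax ay a by (metis closed inv_solve_right m_closed)+
  have ay'': "inv a \<otimes> y = y \<otimes> a"
    using ay a by (metis closed(2) inv_closed inv_solve_left m_assoc m_closed)
  have ax'': "inv a \<otimes> x = x \<otimes> a"
    using ax a by (metis closed(1) inv_closed inv_solve_left m_assoc m_closed)
  have "a \<otimes> (w \<otimes> (x \<otimes> y)) = w \<otimes> (x \<otimes> y) \<otimes> a"
    using a by (simp add: xx[symmetric] m_assoc ax'' ay'' ax' assoc_left[OF ax'] assoc_left[OF ax''])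
  then have "w \<otimes> (x \<otimes> y) \<otimes> (a \<otimes> a) = w \<otimes> (x \<otimes> y)"
    using axy a by (simp add: m_assoc)
  then have aa: "a \<otimes> a = \<one>" using a by simp
  then have "inv a = a" using a by (simp add: inv_equality)
  then show ?thesis using aa ax' ay' by simp
qed simp

lemma w_central:
  assumes [simp]: "a \<in> carrier G"
  shows "a \<otimes> w = w \<otimes> a"
  using xy_L[OF assms]
proof (elim disjE conjE)
  assume "a \<otimes> a = w"
  then show ?thesis by (metis assms m_assoc)
next
  assume "a \<otimes> x = x \<otimes> a"
  then show ?thesis by (metis assms closed(1) m_assoc xx)
qed

lemma square_cases: "a \<in> carrier G \<Longrightarrow> a \<otimes> a = w \<or> a \<in> L"
  using xy_L[of a] by (auto simp: L_def)

lemma L_comm_xy: "a \<in> L \<Longrightarrow> a \<otimes> x = x \<otimes> a" "a \<in> L \<Longrightarrow> a \<otimes> y = y \<otimes> a"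
  using xy_L[of a] quaternion(2) by (auto simp: L_def)

text \<open>The identity ba = a (ab)^2 b holds because \<open>w\<close> is central of order 2, and
  (ab)^2 can only be \<open>w\<close> or 1.\<close>

lemma comm_or_anticomm:
  assumes "a \<in> carrier G" "b \<in> carrier G" "a \<otimes> a = w" "b \<otimes> b = w"
  shows "b \<otimes> a = a \<otimes> b \<or> b \<otimes> a = w \<otimes> (a \<otimes> b)"
proof -
  have "a \<otimes> (a \<otimes> b \<otimes> (a \<otimes> b)) \<otimes> b = w \<otimes> (b \<otimes> a) \<otimes> w"
    using assms by (simp add: m_assoc assoc_left[OF assms(3)])
  also have "\<dots> = b \<otimes> a"
    using assms w_central[of "b \<otimes> a"] by (simp add: m_assoc q_simps)
  finally have eq: "b \<otimes> a = a \<otimes> (a \<otimes> b \<otimes> (a \<otimes> b)) \<otimes> b" ..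
  have "a \<otimes> b \<otimes> (a \<otimes> b) = w \<or> a \<otimes> b \<otimes> (a \<otimes> b) = \<one>"
    using xy_L[of "a \<otimes> b"] assms by auto
  then show ?thesis
  proof
    assume e: "a \<otimes> b \<otimes> (a \<otimes> b) = w"
    have "b \<otimes> a = a \<otimes> w \<otimes> b" using eq unfolding e .
    then show ?thesis using assms by (simp add: w_central m_assoc)
  next
    assume e: "a \<otimes> b \<otimes> (a \<otimes> b) = \<one>"
    have "b \<otimes> a = a \<otimes> \<one> \<otimes> b" using eq unfolding e .
    then show ?thesis using assms by simp
  qed
qed

text \<open>Outside \<open>L\<close>, the element \<open>a\<close> has square \<open>w\<close> and
  commutes with \<open>x\<close> and with \<open>y\<close> up to a factor \<open>w\<close>. If it
  commutes with one of them, their product has square w^2 = 1; otherwise it commutes with xy, which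
  also has square \<open>w\<close>.\<close>

lemma cover:
  assumes [simp]: "a \<in> carrier G"
  shows "a \<in> L \<or> x \<otimes> a \<in> L \<or> y \<otimes> a \<in> L \<or> x \<otimes> y \<otimes> a \<in> L"
proof (cases "a \<in> L")
  case False
  then have aa: "a \<otimes> a = w" using square_cases[OF assms] by auto
  note ax = comm_or_anticomm[OF closed(1) assms xx aa]
  note ay = comm_or_anticomm[OF closed(2) assms quaternion(1) aa]
  note s = q_simps aa assoc_left[OF aa] w_central[OF assms] assoc_left[OF w_central[OF assms]]
  show ?thesis
    using ax
  proof
    assume e: "a \<otimes> x = x \<otimes> a"
    have "x \<otimes> a \<in> L" by (simp add: L_def s e assoc_left[OF e])
    then show ?thesis by simp
  next
    assume e: "a \<otimes> x = w \<otimes> (x \<otimes> a)"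
    from ay show ?thesis
    proof
      assume e: "a \<otimes> y = y \<otimes> a"
      have "y \<otimes> a \<in> L" by (simp add: L_def s e assoc_left[OF e])
      then show ?thesis by simp
    next
      assume e': "a \<otimes> y = w \<otimes> (y \<otimes> a)"
      have "x \<otimes> y \<otimes> a \<in> L" by (simp add: L_def s e e' assoc_left[OF e] assoc_left[OF e'])
      then show ?thesis by simp
    qed
  qed
qed simp

text \<open>Elements of \<open>L\<close> commute with \<open>y\<close>, but x(ab) does not, so its
  square w(ab)^2 is not 1. This leaves (ab)^2 = 1, and inverting ab gives the claim.\<close>

lemma L_comm:
  assumes "a \<in> L" "b \<in> L"
  shows "a \<otimes> b = b \<otimes> a"
proof -
  have ab: "a \<otimes> a = \<one>" "b \<otimes> b = \<one>" and [simp]: "a \<in> carrier G" "b \<in> carrier G"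
    using assms by (auto simp: L_def)
  note ca = L_comm_xy[OF assms(1)] and cb = L_comm_xy[OF assms(2)]
  have "x \<otimes> (a \<otimes> b) \<notin> L"
  proof
    assume "x \<otimes> (a \<otimes> b) \<in> L"
    from L_comm_xy(2)[OF this] have "x \<otimes> y \<otimes> (a \<otimes> b) = y \<otimes> x \<otimes> (a \<otimes> b)"
      by (simp add: m_assoc cb ca assoc_left[OF ca(2)])
    then have "x \<otimes> y = w \<otimes> (x \<otimes> y)" by (simp add: quaternion(4) flip: m_assoc)
    then show False using quaternion(2) by simp
  qed
  then have "x \<otimes> (a \<otimes> b) \<otimes> (x \<otimes> (a \<otimes> b)) \<noteq> \<one>"
    by (simp add: L_def)
  moreover have "x \<otimes> (a \<otimes> b) \<otimes> (x \<otimes> (a \<otimes> b)) = w \<otimes> (a \<otimes> b \<otimes> (a \<otimes> b))"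
    by (simp add: q_simps cb assoc_left[OF cb(1)] assoc_left[OF ca(1)])
  ultimately have "a \<otimes> b \<otimes> (a \<otimes> b) = \<one>"
    using square_cases[of "a \<otimes> b"] quaternion(3) by (auto simp: L_def)
  then have "inv (a \<otimes> b) = a \<otimes> b" by (simp add: inv_equality)
  moreover have "inv a = a" "inv b = b" using ab by (simp_all add: inv_equality)
  ultimately show ?thesis by (simp add: inv_mult_group)
qed

text \<open>By \<open>cover\<close>, multiplying \<open>b\<close> by 1, \<open>x\<close>,
  \<open>y\<close> or xy gives an element of \<open>L\<close>, and \<open>a\<close> commutes with
  all of these.\<close>

lemma L_central:
  assumes a: "a \<in> L" and b [simp]: "b \<in> carrier G"
  shows "a \<otimes> b = b \<otimes> a"
proof -
  have [simp]: "a \<in> carrier G" using a by (rule L_closed)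
  note ca = L_comm_xy[OF a]
  from cover[OF b] show ?thesis
    using L_comm[OF a, of b] L_comm[OF a, of "x \<otimes> b"] L_comm[OF a, of "y \<otimes> b"]
      L_comm[OF a, of "x \<otimes> y \<otimes> b"]
    by (auto simp: m_assoc assoc_left[OF ca(1)] assoc_left[OF ca(2)])
qed

lemma L_mult:
  assumes "a \<in> L" "b \<in> L"
  shows "a \<otimes> b \<in> L"
proof -
  have ab: "a \<otimes> a = \<one>" "b \<otimes> b = \<one>" and [simp]: "a \<in> carrier G" "b \<in> carrier G"
    using assms by (auto simp: L_def)
  have "a \<otimes> b \<otimes> (a \<otimes> b) = a \<otimes> b \<otimes> (b \<otimes> a)" using L_comm[OF assms] by simp
  also have "\<dots> = \<one>" by (simp add: m_assoc ab assoc_left[OF ab(2)])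
  finally show ?thesis by (simp add: L_def)
qed

lemma z_comm: "g \<otimes> z = z \<otimes> g" "h \<otimes> z = z \<otimes> h"
  using L_central[OF z_L g] L_central[OF z_L h] by simp_all

lemmas d_simps = m_assoc z_def[symmetric] assoc_left[OF z_def[symmetric]] hh assoc_left[OF hh]
  zz assoc_left[OF zz] hg assoc_left[OF hg] z_comm assoc_left[OF z_comm(1)] assoc_left[OF z_comm(2)]

section \<open>Cosets of \<open>L\<close> and the corrected homomorphism\<close>

text \<open>Pulls \<open>cover\<close> back along \<open>p\<close>: p(qk) is p(q) p(k) up to the
  element \<open>w\<close> of \<open>L\<close>. If \<open>q\<close> is one of g, h, gh, its inverse
  is zq, whence k = q (z q k).\<close>

lemma decompose:
  assumes [simp]: "k \<in> carrier G"
  shows "\<exists>q\<in>{\<one>, g, h, g \<otimes> h}. \<exists>l\<in>L. k = q \<otimes> l"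
proof -
  \<comment> \<open>The alternative with \<open>w\<close> serves q = gh, whose image is wxy instead
    of xy.\<close>
  have memL: "q \<otimes> k \<in> L" if "p q \<otimes> p k \<in> L \<or> w \<otimes> (p q \<otimes> p k) \<in> L" "q \<in> carrier G" for q
  proof -
    have 1: "p q \<otimes> p k \<in> L"
      using that(1) L_mult[OF w_L, of "w \<otimes> (p q \<otimes> p k)"] that(2)
      by (auto simp: assoc_left[OF quaternion(3)])
    have "p (q \<otimes> k) = p q \<otimes> p k \<or> p (q \<otimes> k) = w \<otimes> (p q \<otimes> p k)"
    proof (cases "p (q \<otimes> k) = p q \<otimes> p k")
      case False
      note tw = twisted[OF that(2) assms False refl]
      have "p q \<otimes> p q = w"
        using square_cases[of "p q"] tw(2) that(2) by (auto simp: L_def)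
      then show ?thesis using tw(5) by simp
    qed simp
    then have "p (q \<otimes> k) \<in> L" using 1 L_mult[OF w_L 1] by auto
    then show ?thesis using that by (simp add: p_mem_L_iff)
  qed
  have *: ?thesis if "q \<otimes> k \<in> L" "q \<otimes> q = z" "q \<in> {g, h, g \<otimes> h}" for q
  proof -
    have [simp]: "q \<in> carrier G" using that by auto
    have "q \<otimes> (z \<otimes> (q \<otimes> k)) = z \<otimes> z \<otimes> k"
    proof -
      have zq: "q \<otimes> z = z \<otimes> q" using L_central[OF z_L, of q] by simp
      show ?thesis by (simp add: m_assoc assoc_left[OF zq] assoc_left[OF that(2)])
    qed
    then have "k = q \<otimes> (z \<otimes> (q \<otimes> k))" by (simp add: zz)
    then show ?thesis using that L_mult[OF z_L that(1)] by blast
  qed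
  have gh2: "g \<otimes> h \<otimes> (g \<otimes> h) = z"
    by (simp add: d_simps)
  from cover[OF p_closed[OF assms]] show ?thesis
  proof (elim disjE)
    assume "p k \<in> L"
    then have "k \<in> L" by (simp add: p_mem_L_iff)
    then show ?thesis by force
  next
    assume "x \<otimes> p k \<in> L"
    then have "g \<otimes> k \<in> L" using memL[of g] by (simp add: x_def)
    then show ?thesis using *[of g] by (simp add: z_def)
  next
    assume "y \<otimes> p k \<in> L"
    then have "h \<otimes> k \<in> L" using memL[of h] by (simp add: y_def)
    then show ?thesis using *[of h] by (simp add: hh)
  next
    assume "x \<otimes> y \<otimes> p k \<in> L"
    then have "g \<otimes> h \<otimes> k \<in> L"
      using memL[of "g \<otimes> h"] by (simp add: quaternion(5) m_assoc assoc_left[OF quaternion(3)])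
    then show ?thesis using *[of "g \<otimes> h"] gh2 by simp
  qed
qed

text \<open>
  The elements 1, g, h, gh represent the cosets of L. Since p(gh) = w p(g) p(h), where w is the
  central element p(g)^2 of order 2, only the values on the coset of gh have to be corrected.
\<close>
definition hom_lift :: "'a \<Rightarrow> 'a" where
  "hom_lift k = (if g \<otimes> h \<otimes> k \<in> L then w \<otimes> p k else p k)"

lemma hom_lift_closed [simp]: "k \<in> carrier G \<Longrightarrow> hom_lift k \<in> carrier G"
  by (simp add: hom_lift_def)

text \<open>As the inverse of gh is z(gh), the test in \<open>hom_lift\<close> singles out the coset
  of gh; multiplying \<open>k\<close> by \<open>l\<close> does not affect it.\<close>

lemma hom_lift_L:
  assumes [simp]: "k \<in> carrier G" and l: "l \<in> L"
  shows "hom_lift (k \<otimes> l) = hom_lift k \<otimes> p l"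
proof -
  have [simp]: "l \<in> carrier G" and ll: "l \<otimes> l = \<one>" using l by (simp_all add: L_def)
  have "g \<otimes> h \<otimes> (k \<otimes> l) \<in> L \<longleftrightarrow> g \<otimes> h \<otimes> k \<in> L"
    using L_mult[OF _ l, of "g \<otimes> h \<otimes> k"] L_mult[OF _ l, of "g \<otimes> h \<otimes> (k \<otimes> l)"]
    by (auto simp: m_assoc ll)
  then show ?thesis
    by (simp add: hom_lift_def p_mult_L[OF _ l] m_assoc)
qed

lemma hom_lift_one: "hom_lift \<one> = \<one>"
  and hom_lift_g: "hom_lift g = x"
  and hom_lift_h: "hom_lift h = y"
  and hom_lift_gh: "hom_lift (g \<otimes> h) = x \<otimes> y"
  using z_ne by (simp_all add: hom_lift_def L_def d_simps quaternion(5) q_simps x_def y_def)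

lemma hom_lift_z: "k \<in> carrier G \<Longrightarrow> hom_lift (z \<otimes> k) = hom_lift k \<otimes> w"
  using hom_lift_L[OF _ z_L, of k] L_central[OF z_L, of k] by (simp add: w_def)

text \<open>Since \<open>l\<close> and its image are central, it suffices to check the four coset
  representatives, where the relations between \<open>g\<close> and \<open>h\<close> match those
  between \<open>x\<close> and \<open>y\<close>.\<close>

lemma hom_lift_generator:
  assumes a: "a \<in> {g, h}" and [simp]: "k \<in> carrier G"
  shows "hom_lift (k \<otimes> a) = hom_lift k \<otimes> p a"
proof -
  obtain q l where q: "q \<in> {\<one>, g, h, g \<otimes> h}" and l: "l \<in> L" and k: "k = q \<otimes> l"
    using decompose[OF assms(2)] by blast
  have [simp]: "q \<in> carrier G" "a \<in> carrier G" "l \<in> carrier G" using q a l L_closed by auto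
  have "hom_lift (q \<otimes> a) = hom_lift q \<otimes> p a"
    using q a hom_lift_z[of \<one>]
    by (auto simp: d_simps q_simps hom_lift_z hom_lift_one hom_lift_g hom_lift_h hom_lift_gh
        simp flip: x_def y_def)
  then have "hom_lift (q \<otimes> a \<otimes> l) = hom_lift q \<otimes> p a \<otimes> p l"
    using hom_lift_L[OF _ l, of "q \<otimes> a"] by simp
  also have "\<dots> = hom_lift k \<otimes> p a"
    using L_central[of "p l" "p a"] l by (simp add: k hom_lift_L[OF _ l] m_assoc p_mem_L_iff)
  finally show ?thesis
    using L_central[OF l, of a] by (simp add: k m_assoc)
qed

text \<open>Each representative \<open>q\<close> is a word of length at most two in \<open>g\<close>
  and \<open>h\<close>, so \<open>hom_lift_generator\<close> applies letter by letter.\<close>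

lemma hom_lift_mult:
  assumes [simp]: "k \<in> carrier G" "m \<in> carrier G"
  shows "hom_lift (k \<otimes> m) = hom_lift k \<otimes> hom_lift m"
proof -
  obtain q l where q: "q \<in> {\<one>, g, h, g \<otimes> h}" and l: "l \<in> L" and m: "m = q \<otimes> l"
    using decompose[OF assms(2)] by blast
  have [simp]: "q \<in> carrier G" "l \<in> carrier G" using q l L_closed by auto
  have "hom_lift (k \<otimes> q) = hom_lift k \<otimes> hom_lift q"
    using q hom_lift_generator[of g k] hom_lift_generator[of h k] hom_lift_generator[of h "k \<otimes> g"]
    by (auto simp: hom_lift_one hom_lift_g hom_lift_h hom_lift_gh m_assoc simp flip: x_def y_def)
  moreover have "hom_lift (k \<otimes> m) = hom_lift (k \<otimes> q) \<otimes> p l"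
    using hom_lift_L[OF _ l, of "k \<otimes> q"] by (simp add: m m_assoc)
  ultimately show ?thesis
    by (simp add: m hom_lift_L[OF _ l] m_assoc)
qed

text \<open>An element \<open>k\<close> of the corrected coset is not in \<open>L\<close>, since gh
  is not. Hence p(k) has square \<open>w\<close>, and multiplication by \<open>w\<close> inverts
  it.\<close>

lemma hom_lift_sign:
  assumes [simp]: "k \<in> carrier G"
  shows "hom_lift k = p k \<or> hom_lift k = inv (p k)"
proof (cases "g \<otimes> h \<otimes> k \<in> L")
  case True
  have "k \<notin> L"
  proof
    assume k: "k \<in> L"
    then have kk: "k \<otimes> k = \<one>" by (simp add: L_def)
    have "g \<otimes> h \<otimes> k \<otimes> k \<in> L" using True k by (rule L_mult)
    then have "g \<otimes> h \<in> L" by (simp add: m_assoc kk)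
    then show False using z_ne by (simp add: L_def d_simps)
  qed
  then have "p k \<otimes> p k = w"
    using square_cases[of "p k"] by (simp add: p_mem_L_iff)
  then have "inv (p k) = w \<otimes> p k"
    by (intro inv_equality) (simp_all add: m_assoc quaternion(3))
  then show ?thesis by (simp add: hom_lift_def)
qed (simp add: hom_lift_def)

end

section \<open>Passage to a group automorphism\<close>

text \<open>Either \<open>p\<close> itself or \<open>hom_lift\<close> is a homomorphism. Agreement
  with \<open>p\<close> up to inversion makes its kernel trivial and its image the whole
  group.\<close>

lemma (in sign_mult_bij) ex_iso:
  "\<exists>\<alpha> \<in> iso G G. \<forall>k\<in>carrier G. \<alpha> k = p k \<or> \<alpha> k = inv (p k)"
proof -
  have "\<exists>\<alpha>\<in>hom G G. \<forall>k\<in>carrier G. \<alpha> k = p k \<or> \<alpha> k = inv (p k)"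
  proof (cases "\<forall>g\<in>carrier G. \<forall>h\<in>carrier G. p (g \<otimes> h) = p g \<otimes> p h")
    case True
    then show ?thesis by (intro bexI[of _ p]) (auto simp: hom_def)
  next
    case False
    then obtain g h where "g \<in> carrier G" "h \<in> carrier G" "p (g \<otimes> h) \<noteq> p g \<otimes> p h" by blast
    then interpret twisted_pair G p g h by unfold_locales
    show ?thesis
      using hom_lift_mult hom_lift_sign by (intro bexI[of _ hom_lift]) (auto simp: hom_def)
  qed
  then obtain \<alpha> where hom: "\<alpha> \<in> hom G G" and
    sign: "\<And>k. k \<in> carrier G \<Longrightarrow> \<alpha> k = p k \<or> \<alpha> k = inv (p k)" by blast
  interpret \<alpha>: group_hom G G \<alpha>
    using hom by (simp add: group_hom_def group_hom_axioms_def is_group)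
  have ker: "k = \<one>" if "k \<in> carrier G" "\<alpha> k = \<one>" for k
    using sign[OF that(1)] that p_eq_one[of k] by (metis inv_inv inv_one p_closed)
  have "inj_on \<alpha> (carrier G)"
    using ker by (simp add: \<alpha>.inj_on_one_iff)
  moreover have "\<alpha> ` carrier G = carrier G"
  proof (intro equalityI subsetI)
    fix a assume a: "a \<in> carrier G"
    then obtain k where k: "k \<in> carrier G" "p k = a" using p_surj by blast
    then have "\<alpha> k = a \<or> \<alpha> (inv k) = a" using sign[of k] by auto
    then show "a \<in> \<alpha> ` carrier G" using k by blast
  qed auto
  ultimately show ?thesis
    using hom sign by (intro bexI[of _ \<alpha>]) (auto simp: iso_def bij_betw_def)
qed

section \<open>Colour-permuting automorphisms of the complete Cayley graph\<close>

theorem theorem1p3: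
  fixes G :: "('a, 'b) monoid_scheme" and f :: "'a \<Rightarrow> 'a"
  assumes "group G"
    and "colour_permuting G (carrier G - {\<one>\<^bsub>G\<^esub>}) f"
  shows "\<exists>\<alpha> \<psi>. \<alpha> \<in> Group.iso G G \<and> colour_preserving G (carrier G - {\<one>\<^bsub>G\<^esub>}) \<psi> \<and>
           (\<forall>x\<in>carrier G. f x = \<alpha> (\<psi> x))"
proof -
  interpret group G by fact
  let ?E = "cay_edge G (carrier G - {\<one>\<^bsub>G\<^esub>})"
  have edge: "?E g h \<longleftrightarrow> g \<in> carrier G \<and> h \<in> carrier G \<and> g \<noteq> h" for g h
  proof -
    have "inv\<^bsub>G\<^esub> g \<otimes>\<^bsub>G\<^esub> h = \<one>\<^bsub>G\<^esub> \<longleftrightarrow> g = h" if "g \<in> carrier G" "h \<in> carrier G"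
      using that by (metis inv_closed inv_comm inv_equality inv_inv l_inv)
    then show ?thesis by (auto simp: cay_edge_def)
  qed
  have f_bij: "bij_betw f (carrier G) (carrier G)"
    and perm: "\<And>g h g' h'. \<lbrakk>?E g h; ?E g' h'; cay_colour G g h = cay_colour G g' h'\<rbrakk>
      \<Longrightarrow> cay_colour G (f g) (f h) = cay_colour G (f g') (f h')"
    using assms(2) unfolding colour_permuting_def cay_graph_aut_def by blast+
  have f [simp]: "f x \<in> carrier G" if "x \<in> carrier G" for x
    using f_bij that bij_betwE by blast
  define a where "a = f \<one>\<^bsub>G\<^esub>"
  have a [simp]: "a \<in> carrier G" by (simp add: a_def)
  \<comment> \<open>This translation makes the map fix the identity and leaves the quotients f(g)^-1
    f(h) unchanged.\<close>
  define p where "p x = inv\<^bsub>G\<^esub> a \<otimes>\<^bsub>G\<^esub> f x" for x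
  have p [simp]: "p x \<in> carrier G" if "x \<in> carrier G" for x
    using that by (simp add: p_def)
  \<comment> \<open>The edges from \<open>g\<close> to \<open>h\<close> and from 1 to g^-1 h have
    the same colour, hence so do their images. For g = h there is no edge, and all terms are the
    identity.\<close>
  have diff: "inv\<^bsub>G\<^esub> (f g) \<otimes>\<^bsub>G\<^esub> f h \<in> {p (inv\<^bsub>G\<^esub> g \<otimes>\<^bsub>G\<^esub> h), inv\<^bsub>G\<^esub> (p (inv\<^bsub>G\<^esub> g \<otimes>\<^bsub>G\<^esub> h))}"
    if "g \<in> carrier G" "h \<in> carrier G" for g h
  proof (cases "g = h")
    case True
    then show ?thesis using that by (simp add: p_def a_def)
  next
    case False
    let ?k = "inv\<^bsub>G\<^esub> g \<otimes>\<^bsub>G\<^esub> h"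
    have "?k \<noteq> \<one>\<^bsub>G\<^esub>" using edge[of g h] that False by (simp add: cay_edge_def)
    then have "cay_colour G (f g) (f h) = cay_colour G (f \<one>\<^bsub>G\<^esub>) (f ?k)"
      using that False by (intro perm) (auto simp: edge cay_colour_def)
    then show ?thesis
      unfolding cay_colour_def by (auto simp: p_def a_def)
  qed
  interpret sign_mult_bij G p
  proof
    have "bij_betw (\<lambda>x. inv\<^bsub>G\<^esub> a \<otimes>\<^bsub>G\<^esub> x) (carrier G) (carrier G)"
      by (rule bij_betw_byWitness[where f' = "\<lambda>x. a \<otimes>\<^bsub>G\<^esub> x"]) auto
    from bij_betw_trans[OF f_bij this] show "bij_betw p (carrier G) (carrier G)"
      by (rule bij_betw_cong[THEN iffD1, rotated]) (simp add: p_def)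
  next
    fix g h assume [simp]: "g \<in> carrier G" "h \<in> carrier G"
    have "inv\<^bsub>G\<^esub> (p g) \<otimes>\<^bsub>G\<^esub> p (g \<otimes>\<^bsub>G\<^esub> h) = inv\<^bsub>G\<^esub> (f g) \<otimes>\<^bsub>G\<^esub> f (g \<otimes>\<^bsub>G\<^esub> h)"
      by (simp add: p_def inv_mult_group m_assoc)
    also have "\<dots> \<in> {p h, inv\<^bsub>G\<^esub> (p h)}"
      using diff[of g "g \<otimes>\<^bsub>G\<^esub> h"] by simp
    finally have "p (g \<otimes>\<^bsub>G\<^esub> h) \<in> {p g \<otimes>\<^bsub>G\<^esub> p h, p g \<otimes>\<^bsub>G\<^esub> inv\<^bsub>G\<^esub> (p h)}"
      by (metis \<open>g \<in> carrier G\<close> \<open>h \<in> carrier G\<close> insert_iff l_cancel_inv(2) m_closed p singletonD)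
    then show "p (g \<otimes>\<^bsub>G\<^esub> h) = p g \<otimes>\<^bsub>G\<^esub> p h \<or> p (g \<otimes>\<^bsub>G\<^esub> h) = p g \<otimes>\<^bsub>G\<^esub> inv\<^bsub>G\<^esub> (p h)"
      by simp
  qed
  obtain \<alpha> where iso: "\<alpha> \<in> Group.iso G G" and
    sign: "\<And>k. k \<in> carrier G \<Longrightarrow> \<alpha> k = p k \<or> \<alpha> k = inv\<^bsub>G\<^esub> (p k)"
    using ex_iso by blast
  interpret \<alpha>: group_hom G G \<alpha>
    using iso by (simp add: group_hom_def group_hom_axioms_def is_group iso_def)
  have \<alpha>_bij: "bij_betw \<alpha> (carrier G) (carrier G)" using iso by (simp add: iso_def)
  then have \<alpha>_inj: "\<And>u v. \<lbrakk>u \<in> carrier G; v \<in> carrier G; \<alpha> u = \<alpha> v\<rbrakk> \<Longrightarrow> u = v"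
    by (meson bij_betw_imp_inj_on inj_onD)
  \<comment> \<open>Here \<open>f\<close> appears and not \<open>p\<close>: left translations
    preserve colours, so the translation by \<open>a\<close> is absorbed in \<psi>.\<close>
  define \<psi> where "\<psi> x = inv_into (carrier G) \<alpha> (f x)" for x
  then have \<psi>_eq: "\<psi> = inv_into (carrier G) \<alpha> \<circ> f" by auto
  have \<psi>_bij: "bij_betw \<psi> (carrier G) (carrier G)"
    unfolding \<psi>_eq using f_bij bij_betw_inv_into[OF \<alpha>_bij] by (rule bij_betw_trans)
  then have \<psi> [simp]: "\<psi> x \<in> carrier G" if "x \<in> carrier G" for x
    using that bij_betwE by blast
  have \<alpha>\<psi>: "\<alpha> (\<psi> x) = f x" if "x \<in> carrier G" for x
    using that \<alpha>_bij by (simp add: \<psi>_def bij_betw_inv_into_right)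
  have "cay_colour G (\<psi> g) (\<psi> h) = cay_colour G g h" if [simp]: "g \<in> carrier G" "h \<in> carrier G" for g h
  proof -
    let ?k = "inv\<^bsub>G\<^esub> g \<otimes>\<^bsub>G\<^esub> h"
    let ?m = "inv\<^bsub>G\<^esub> (\<psi> g) \<otimes>\<^bsub>G\<^esub> \<psi> h"
    have "\<alpha> ?m = inv\<^bsub>G\<^esub> (f g) \<otimes>\<^bsub>G\<^esub> f h"
      by (simp add: \<alpha>\<psi>)
    \<comment> \<open>As \<alpha> agrees with \<open>p\<close> up to inversion, both values allowed
      by \<open>diff\<close> are images under \<alpha> of the quotient or its inverse.\<close>
    also have "\<dots> \<in> {\<alpha> ?k, \<alpha> (inv\<^bsub>G\<^esub> ?k)}"
      using diff[of g h] sign[of ?k] by (auto simp del: \<alpha>.hom_mult)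
    finally have "\<alpha> ?m = \<alpha> ?k \<or> \<alpha> ?m = \<alpha> (inv\<^bsub>G\<^esub> ?k)" by blast
    moreover have "?m \<in> carrier G" "?k \<in> carrier G" "inv\<^bsub>G\<^esub> ?k \<in> carrier G" by simp_all
    ultimately have "?m = ?k \<or> ?m = inv\<^bsub>G\<^esub> ?k" using \<alpha>_inj by blast
    then show ?thesis
    proof
      assume "?m = inv\<^bsub>G\<^esub> ?k"
      then show ?thesis
        unfolding cay_colour_def \<open>?m = inv\<^bsub>G\<^esub> ?k\<close> by (simp add: insert_commute)
    qed (simp add: cay_colour_def)
  qed
  moreover have "cay_graph_aut G (carrier G - {\<one>\<^bsub>G\<^esub>}) \<psi>"
    using \<psi>_bij by (auto simp: cay_graph_aut_def edge bij_betw_def dest: inj_onD)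
  ultimately have "colour_preserving G (carrier G - {\<one>\<^bsub>G\<^esub>}) \<psi>"
    by (simp add: colour_preserving_def edge)
  then show ?thesis
    using iso \<alpha>\<psi> by (intro exI[of _ \<alpha>] exI[of _ \<psi>]) auto
qed

end
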